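(* Let $n\ge 2$, let $a,b\in\mathbb{C}$, let $\mathcal{H}$ be a nonzero complex Hilbert space and $B\in\mathcal{B}(\mathcal{H})$, and let $A=Circ(-a,b,b,\ldots,b)\in\mathcal{M}_n(\mathbb{C})$. Then: (1) $\|A\otimes B\|_2=\max\{|a+b|,\ |(n-1)b-a|\}\,\|B\|$. (2) $w(A\otimes B)=\max\{|a+b|,\ |(n-1)b-a|\}\,w(B)$.
   Context: $Circ(a_1,a_2,\dots,a_n)$ is the $n\times n$ circulant matrix with first row $(a_1,a_2,\dots,a_n)$, each subsequent row being the cyclic right shift of the previous one; thus $Circ(-a,b,\dots,b)$ has all diagonal entries $-a$ and all off-diagonal entries $b$. $\mathcal{B}(\mathcal{H})$ denotes the bounded linear operators on $\mathcal{H}$ and $\|\cdot\|$ the operator norm. The numerical radius of a bounded operator $T$ on a complex Hilbert space $\mathcal{K}$ is $w(T)=\sup\{|\langle Tx,x\rangle| : x\in\mathcal{K},\ \|x\|=1\}$. $A\otimes B=[a_{ij}B]_{i,j=1}^n$ is the operator matrix acting on $\mathcal{H}^n=\mathcal{H}^{\oplus n}$, and $\|A\otimes B\|_2$ is its operator norm with respect to $\|x\|_2=\left(\sum_{j=1}^n\|x_j\|^2\right)^{1/2}$ for $x=(x_1,\dots,x_n)^T\in\mathcal{H}^n$. *)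

theory Defs
  imports "HOL-Analysis.Analysis"
begin

text \<open>
  Complex inner product spaces and Hilbert spaces as type classes over the library's real normed
  spaces. The inner product is linear in the first argument and conjugate linear in the second.
  Positivity and definiteness of the inner product are contained in \<open>cinner_self\<close>, given the
  axioms of a norm.
\<close>

class complex_inner = real_normed_vector +
  fixes scaleC :: "complex \<Rightarrow> 'a \<Rightarrow> 'a"  (infixr \<open>*\<^sub>C\<close> 75)
    and cinner :: "'a \<Rightarrow> 'a \<Rightarrow> complex"
  assumes scaleC_add_right: "c *\<^sub>C (x + y) = c *\<^sub>C x + c *\<^sub>C y"
    and scaleC_add_left: "(c + d) *\<^sub>C x = c *\<^sub>C x + d *\<^sub>C x"
    and scaleC_scaleC: "c *\<^sub>C d *\<^sub>C x = (c * d) *\<^sub>C x"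
    and scaleC_one: "1 *\<^sub>C x = x"
    and scaleR_scaleC: "scaleR r x = complex_of_real r *\<^sub>C x"
    and cinner_commute: "cinner x y = cnj (cinner y x)"
    and cinner_add_left: "cinner (x + y) z = cinner x z + cinner y z"
    and cinner_scaleC_left: "cinner (c *\<^sub>C x) y = c * cinner x y"
    and cinner_self: "cinner x x = complex_of_real ((norm x)\<^sup>2)"

class chilbert_space = complex_inner + complete_space

instantiation complex :: chilbert_space
begin

definition scaleC_complex :: "complex \<Rightarrow> complex \<Rightarrow> complex"
  where "scaleC_complex c x = c * x"

definition cinner_complex :: "complex \<Rightarrow> complex \<Rightarrow> complex"
  where "cinner_complex x y = x * cnj y"

instance
  by standard
    (auto simp: scaleC_complex_def cinner_complex_def algebra_simps scaleR_conv_of_real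
      simp flip: complex_norm_square)

end

text \<open>
  The direct sum of copies of a space, indexed by a finite type; the norm that the library puts
  on it is the Euclidean combination of the norms of the components.
\<close>

instantiation vec :: (complex_inner, finite) complex_inner
begin

definition scaleC_vec :: "complex \<Rightarrow> 'a ^ 'b \<Rightarrow> 'a ^ 'b"
  where "scaleC_vec c x = (\<chi> i. c *\<^sub>C (x $ i))"

definition cinner_vec :: "'a ^ 'b \<Rightarrow> 'a ^ 'b \<Rightarrow> complex"
  where "cinner_vec x y = (\<Sum>i\<in>UNIV. cinner (x $ i) (y $ i))"

instance
proof
  fix x y z :: "'a ^ 'b" and c d :: complex and r :: real
  show "c *\<^sub>C (x + y) = c *\<^sub>C x + c *\<^sub>C y"
    by (simp add: scaleC_vec_def vec_eq_iff scaleC_add_right)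
  show "(c + d) *\<^sub>C x = c *\<^sub>C x + d *\<^sub>C x"
    by (simp add: scaleC_vec_def vec_eq_iff scaleC_add_left)
  show "c *\<^sub>C d *\<^sub>C x = (c * d) *\<^sub>C x"
    by (simp add: scaleC_vec_def vec_eq_iff scaleC_scaleC)
  show "1 *\<^sub>C x = x"
    by (simp add: scaleC_vec_def vec_eq_iff scaleC_one)
  show "scaleR r x = complex_of_real r *\<^sub>C x"
    by (simp add: scaleC_vec_def vec_eq_iff scaleR_scaleC)
  show "cinner x y = cnj (cinner y x)"
    by (simp add: cinner_vec_def flip: cinner_commute)
  show "cinner (x + y) z = cinner x z + cinner y z"
    by (simp add: cinner_vec_def cinner_add_left sum.distrib)
  show "cinner (c *\<^sub>C x) y = c * cinner x y"
    by (simp add: cinner_vec_def scaleC_vec_def cinner_scaleC_left sum_distrib_left)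
  show "cinner x x = complex_of_real ((norm x)\<^sup>2)"
    by (simp add: cinner_vec_def cinner_self norm_vec_def L2_set_def sum_nonneg)
qed

end

instance vec :: (chilbert_space, finite) chilbert_space ..

definition bounded_clinear :: "('a::complex_inner \<Rightarrow> 'b::complex_inner) \<Rightarrow> bool"
  where "bounded_clinear T \<longleftrightarrow> bounded_linear T \<and> (\<forall>c x. T (c *\<^sub>C x) = c *\<^sub>C T x)"

definition numerical_radius :: "('k::chilbert_space \<Rightarrow> 'k) \<Rightarrow> real"
  where "numerical_radius T = (SUP x\<in>{x. norm x = 1}. cmod (cinner (T x) x))"

text \<open>
  Zero-based position of an index. On a finite linear order with \<open>n\<close> elements this is the
  order isomorphism onto \<open>{..<n}\<close>.
\<close>

definition pos :: "'n::{finite,linorder} \<Rightarrow> nat"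
  where "pos i = card {k. k < i}"

text \<open>
  Circulant matrix with first row \<open>as\<close>, where \<open>as\<close> is meant to have length \<open>CARD('n)\<close>: row \<open>i\<close> is
  the first row shifted cyclically \<open>pos i\<close> places to the right.
\<close>

definition Circ :: "complex list \<Rightarrow> complex ^ ('n::{finite,linorder}) ^ ('n::{finite,linorder})"
  where "Circ as = (\<chi> i j. as ! ((pos j + CARD('n) - pos i) mod CARD('n)))"

definition op_matrix_apply :: "('h \<Rightarrow> 'h) ^ 'n ^ 'n \<Rightarrow> 'h ^ 'n \<Rightarrow> 'h::chilbert_space ^ 'n"
  where "op_matrix_apply M x = (\<chi> i. \<Sum>j\<in>UNIV. (M $ i $ j) (x $ j))"

definition op_tensor ::
    "complex ^ 'n ^ 'n \<Rightarrow> ('h \<Rightarrow> 'h) \<Rightarrow> 'h ^ 'n \<Rightarrow> 'h::chilbert_space ^ 'n"  (infixl \<open>\<otimes>\<^sub>o\<^sub>p\<close> 70)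
  where "A \<otimes>\<^sub>o\<^sub>p B = op_matrix_apply (\<chi> i j. (\<lambda>x. (A $ i $ j) *\<^sub>C B x))"

end

theory Submission
  imports Defs
begin

text \<open>
  Write \<open>\<mu> = (n - 1) * b - a\<close>. The matrix \<open>A\<close> is \<open>b\<close> times the all-ones matrix minus \<open>a + b\<close> times the
  identity. It acts as \<open>\<mu>\<close> on the constant vectors and as \<open>- (a + b)\<close> on the vectors of sum zero,
  and these two subspaces are orthogonal complements of each other.

  Every vector \<open>x\<close> of the direct sum splits in the same way as \<open>u + v\<close>, where \<open>u\<close> repeats the mean
  of the components of \<open>x\<close> and \<open>v\<close> has sum zero. Since \<open>B\<close> is linear, applying it in each component
  keeps \<open>u\<close> constant and keeps the sum of \<open>v\<close> zero. So the images are again orthogonal, and both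
  the squared norm of \<open>(A \<otimes>\<^sub>o\<^sub>p B) x\<close> and its inner product with \<open>x\<close> are sums of one term for \<open>u\<close> and
  one for \<open>v\<close>, without cross terms (\<open>op_tensor_decomposition\<close>). With \<open>M\<close> the larger of the moduli
  of the two eigenvalues, estimating the terms separately and adding by Pythagoras gives the upper
  bounds \<open>M * onorm B\<close> and \<open>M * numerical_radius B\<close>.

  The lower bounds hold for any matrix: if \<open>A c = k c\<close> with \<open>c \<noteq> 0\<close>, then \<open>A \<otimes>\<^sub>o\<^sub>p B\<close> acts as \<open>k B\<close> on the
  copy of the space formed by the tensors of \<open>c\<close> with vectors \<open>h\<close>
  (\<open>cmod_eigenvalue_mult_onorm_le\<close>, \<open>cmod_eigenvalue_mult_numerical_radius_le\<close>). Here \<open>c\<close> is the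
  constant vector for \<open>\<mu>\<close>, and a difference of two unit vectors for \<open>- (a + b)\<close>; the latter is where
  \<open>n \<ge> 2\<close> enters.
\<close>

section \<open>Complex inner product spaces\<close>

interpretation cvs: vector_space "scaleC :: complex \<Rightarrow> 'a::complex_inner \<Rightarrow> 'a"
  by standard (simp_all add: scaleC_add_right scaleC_add_left scaleC_scaleC scaleC_one)

lemma cinner_add_right: "cinner x (y + z) = cinner x y + cinner x z"
  by (metis cinner_commute cinner_add_left complex_cnj_add)

lemma cinner_scaleC_right: "cinner x (c *\<^sub>C y) = cnj c * cinner x y"
  by (metis cinner_commute cinner_scaleC_left complex_cnj_mult)

lemma additive_cinner_left: "Modules.additive (\<lambda>x. cinner x y)"
  by (rule Modules.additive.intro) (rule cinner_add_left)

lemma additive_cinner_right: "Modules.additive (cinner x)"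
  by (rule Modules.additive.intro) (rule cinner_add_right)

lemmas cinner_sum_left = Modules.additive.sum [OF additive_cinner_left]
lemmas cinner_sum_right = Modules.additive.sum [OF additive_cinner_right]
lemmas cinner_zero_left [simp] = Modules.additive.zero [OF additive_cinner_left]
lemmas cinner_zero_right [simp] = Modules.additive.zero [OF additive_cinner_right]

lemma norm_scaleC: "norm (c *\<^sub>C x) = cmod c * norm x"
proof -
  have "cinner (c *\<^sub>C x) (c *\<^sub>C x) = c * cnj c * cinner x x"
    by (simp add: cinner_scaleC_left cinner_scaleC_right)
  then have "(norm (c *\<^sub>C x))\<^sup>2 = (cmod c * norm x)\<^sup>2"
    unfolding cinner_self complex_norm_square [symmetric] power_mult_distrib
      of_real_mult [symmetric] of_real_power [symmetric] of_real_eq_iff .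
  then show ?thesis
    by (rule power2_eq_imp_eq) auto
qed

lemma scaleC_scaleR: "c *\<^sub>C (r *\<^sub>R x) = r *\<^sub>R (c *\<^sub>C x)"
  by (simp add: scaleR_scaleC mult.commute)

lemma norm_add_squared:
  "(norm (x + y))\<^sup>2 = (norm x)\<^sup>2 + 2 * Re (cinner x y) + (norm y)\<^sup>2"
proof -
  have "(norm z)\<^sup>2 = Re (cinner z z)" for z :: 'a
    by (simp add: cinner_self)
  moreover have "Re (cinner y x) = Re (cinner x y)"
    by (subst cinner_commute) simp
  ultimately show ?thesis
    by (simp add: cinner_add_left cinner_add_right)
qed

text \<open>
  The axioms supply the norm with its triangle inequality, so Cauchy--Schwarz is derived from it:
  squaring \<open>norm (x + y) \<le> norm x + norm y\<close> bounds the real part of the inner product, and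
  rotating \<open>x\<close> by a phase turns the real part into the modulus.
\<close>

lemma cmod_cinner_le_norm: "cmod (cinner x y) \<le> norm x * norm y"
proof -
  have Re_le: "Re (cinner z y) \<le> norm z * norm y" for z
  proof -
    have "(norm (z + y))\<^sup>2 \<le> (norm z + norm y)\<^sup>2"
      by (intro power_mono norm_triangle_ineq norm_ge_zero)
    then show ?thesis
      by (simp add: norm_add_squared power2_sum)
  qed
  \<comment> \<open>The phase is the conjugate sign of the inner product, or anything if that vanishes.\<close>
  obtain c where c: "cmod c = 1" "c * cinner x y = cmod (cinner x y)"
  proof (cases "cinner x y = 0")
    case True
    then show ?thesis using that [of 1] by simp
  next
    case False
    then have "cnj (sgn (cinner x y)) * cinner x y = cmod (cinner x y)"
      using complex_norm_square [of "cinner x y"]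
      by (simp add: sgn_eq power2_eq_square field_simps)
    with False show ?thesis
      using that [of "cnj (sgn (cinner x y))"] by (simp add: norm_sgn)
  qed
  have "cmod (cinner x y) = Re (cinner (c *\<^sub>C x) y)"
    by (simp add: cinner_scaleC_left c)
  also have "\<dots> \<le> norm x * norm y"
    using Re_le [of "c *\<^sub>C x"] by (simp add: norm_scaleC c)
  finally show ?thesis .
qed

section \<open>The numerical radius\<close>

lemma cmod_cinner_le_onorm:
  assumes "bounded_linear T"
  shows "cmod (cinner (T x) x) \<le> onorm T * (norm x)\<^sup>2"
proof -
  have "cmod (cinner (T x) x) \<le> norm (T x) * norm x"
    by (rule cmod_cinner_le_norm)
  also have "\<dots> \<le> (onorm T * norm x) * norm x"
    by (intro mult_right_mono onorm assms norm_ge_zero)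
  finally show ?thesis by (simp add: power2_eq_square mult.assoc)
qed

text \<open>
  The supremum over unit vectors becomes a bound for all vectors because the quadratic form is
  homogeneous of degree two. Boundedness of \<open>T\<close> makes the set of values bounded above; only then
  does the supremum bound its elements.
\<close>

lemma cinner_le_numerical_radius:
  fixes T :: "'k::chilbert_space \<Rightarrow> 'k"
  assumes "bounded_linear T"
  shows "cmod (cinner (T x) x) \<le> numerical_radius T * (norm x)\<^sup>2"
proof (cases "x = 0")
  case False
  interpret bounded_linear T by fact
  define y where "y = sgn x"
  have "norm y = 1"
    using False by (simp add: y_def norm_sgn)
  have x_eq: "x = norm x *\<^sub>R y"
    using False by (simp add: y_def sgn_div_norm)
  have Tx: "T x = norm x *\<^sub>R T y"
    using scaleR [of "norm x" y] x_eq by simp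
  have "bdd_above ((\<lambda>x. cmod (cinner (T x) x)) ` {x. norm x = 1})"
  proof (rule bdd_aboveI2)
    show "cmod (cinner (T z) z) \<le> onorm T" if "z \<in> {x. norm x = 1}" for z
      using cmod_cinner_le_onorm [OF assms, of z] that by simp
  qed
  then have "cmod (cinner (T y) y) \<le> numerical_radius T"
    unfolding numerical_radius_def by (rule cSUP_upper2) (use \<open>norm y = 1\<close> in auto)
  then have "(norm x)\<^sup>2 * cmod (cinner (T y) y) \<le> (norm x)\<^sup>2 * numerical_radius T"
    by (intro mult_left_mono) auto
  moreover have "cinner (norm x *\<^sub>R T y) (norm x *\<^sub>R y)
      = complex_of_real ((norm x)\<^sup>2) * cinner (T y) y"
    by (simp add: scaleR_scaleC cinner_scaleC_left cinner_scaleC_right power2_eq_square)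
  then have "cmod (cinner (T x) x) = (norm x)\<^sup>2 * cmod (cinner (T y) y)"
    by (simp add: norm_mult norm_power flip: Tx x_eq)
  ultimately show ?thesis by (simp add: mult.commute)
qed simp

lemma exists_norm_1:
  assumes "\<exists>x::'k::real_normed_vector. x \<noteq> 0"
  shows "\<exists>x::'k. norm x = 1"
  using assms norm_sgn by metis

text \<open>The space has to be nonzero here, since a supremum of reals over the empty set is
  an unspecified value.\<close>

lemma numerical_radius_le:
  fixes T :: "'k::chilbert_space \<Rightarrow> 'k"
  assumes "\<exists>x::'k. x \<noteq> 0"
    and "\<And>x. cmod (cinner (T x) x) \<le> c * (norm x)\<^sup>2"
  shows "numerical_radius T \<le> c"
  unfolding numerical_radius_def
proof (rule cSUP_least)
  show "{x::'k. norm x = 1} \<noteq> {}"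
    using exists_norm_1 [OF assms(1)] by blast
  show "cmod (cinner (T x) x) \<le> c" if "x \<in> {x. norm x = 1}" for x
    using assms(2) [of x] that by simp
qed

section \<open>Operator tensor products and eigenvectors of the matrix\<close>

lemma op_tensor_nth: "(A \<otimes>\<^sub>o\<^sub>p B) x $ i = (\<Sum>j\<in>UNIV. (A $ i $ j) *\<^sub>C B (x $ j))"
  by (simp add: op_tensor_def op_matrix_apply_def)

lemma bounded_linear_op_tensor:
  assumes "bounded_linear B"
  shows "bounded_linear (A \<otimes>\<^sub>o\<^sub>p B)"
proof -
  interpret bounded_linear B by fact
  show ?thesis
  proof (rule bounded_linear_intro)
    fix x y :: "'a ^ 'b" and r :: real
    show "(A \<otimes>\<^sub>o\<^sub>p B) (x + y) = (A \<otimes>\<^sub>o\<^sub>p B) x + (A \<otimes>\<^sub>o\<^sub>p B) y"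
      by (simp add: vec_eq_iff op_tensor_nth add scaleC_add_right sum.distrib)
    show "(A \<otimes>\<^sub>o\<^sub>p B) (r *\<^sub>R x) = r *\<^sub>R (A \<otimes>\<^sub>o\<^sub>p B) x"
      by (simp add: vec_eq_iff op_tensor_nth scaleR scaleC_scaleR scaleR_sum_right)
    have "norm ((A \<otimes>\<^sub>o\<^sub>p B) x) \<le> (\<Sum>i\<in>UNIV. norm ((A \<otimes>\<^sub>o\<^sub>p B) x $ i))"
      unfolding norm_vec_def by (rule L2_set_le_sum) simp
    also have "\<dots> \<le> (\<Sum>i\<in>UNIV. \<Sum>j\<in>UNIV. cmod (A $ i $ j) * (onorm B * norm x))"
    proof (rule sum_mono)
      fix i
      have "norm ((A \<otimes>\<^sub>o\<^sub>p B) x $ i) \<le> (\<Sum>j\<in>UNIV. norm ((A $ i $ j) *\<^sub>C B (x $ j)))"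
        unfolding op_tensor_nth by (rule norm_sum)
      also have "\<dots> \<le> (\<Sum>j\<in>UNIV. cmod (A $ i $ j) * (onorm B * norm x))"
        unfolding norm_scaleC
      proof (intro sum_mono mult_left_mono norm_ge_zero)
        fix j
        have "norm (B (x $ j)) \<le> onorm B * norm (x $ j)"
          by (rule onorm [OF assms])
        also have "\<dots> \<le> onorm B * norm x"
          by (intro mult_left_mono onorm_pos_le assms Finite_Cartesian_Product.norm_nth_le)
        finally show "norm (B (x $ j)) \<le> onorm B * norm x" .
      qed
      finally show "norm ((A \<otimes>\<^sub>o\<^sub>p B) x $ i)
          \<le> (\<Sum>j\<in>UNIV. cmod (A $ i $ j) * (onorm B * norm x))" .
    qed
    finally show "norm ((A \<otimes>\<^sub>o\<^sub>p B) x)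
        \<le> norm x * (\<Sum>i\<in>UNIV. \<Sum>j\<in>UNIV. cmod (A $ i $ j) * onorm B)"
      by (simp add: sum_distrib_left mult_ac)
  qed
qed

text \<open>
  The pure tensor of \<open>c\<close> and \<open>h\<close>, under the identification of the direct sum with the tensor
  product of the coordinate space and the Hilbert space.
\<close>

definition pure_tensor :: "complex ^ 'n \<Rightarrow> 'h \<Rightarrow> 'h::complex_inner ^ 'n"
  where "pure_tensor c h = (\<chi> i. (c $ i) *\<^sub>C h)"

lemma cinner_pure_tensor:
  "cinner (pure_tensor c h) (pure_tensor d k) = cinner c d * cinner h k"
  by (simp add: pure_tensor_def cinner_vec_def cinner_scaleC_left cinner_scaleC_right
      cinner_complex_def sum_distrib_left mult_ac)

lemma norm_pure_tensor: "norm (pure_tensor c h) = norm c * norm h"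
proof -
  have "cinner (pure_tensor c h) (pure_tensor c h) = cinner c c * cinner h h"
    by (rule cinner_pure_tensor)
  then have "(norm (pure_tensor c h))\<^sup>2 = (norm c * norm h)\<^sup>2"
    unfolding cinner_self power_mult_distrib of_real_mult [symmetric] of_real_eq_iff .
  then show ?thesis
    by (rule power2_eq_imp_eq) auto
qed

lemma op_tensor_pure_tensor:
  assumes "bounded_clinear B"
  shows "(A \<otimes>\<^sub>o\<^sub>p B) (pure_tensor c h) = pure_tensor (A *v c) (B h)"
  using assms
  by (simp add: vec_eq_iff op_tensor_nth pure_tensor_def bounded_clinear_def
      matrix_vector_mult_def cvs.scale_sum_left)

lemma pure_tensor_scaleC: "pure_tensor (k *\<^sub>C c) h = k *\<^sub>C pure_tensor c h"
  by (simp add: vec_eq_iff pure_tensor_def scaleC_vec_def scaleC_complex_def)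

text \<open>
  Tensoring with an eigenvector \<open>c\<close> embeds the Hilbert space, up to the factor \<open>norm c\<close>, as an
  invariant subspace on which \<open>A \<otimes>\<^sub>o\<^sub>p B\<close> is \<open>k\<close> times a copy of \<open>B\<close>. So operator norm and numerical
  radius are at least those of \<open>k\<close> times \<open>B\<close>.
\<close>

lemma cmod_eigenvalue_mult_onorm_le:
  fixes B :: "'h::chilbert_space \<Rightarrow> 'h"
  assumes B: "bounded_clinear B" and eigen: "A *v c = k *\<^sub>C c" and "c \<noteq> 0"
  shows "cmod k * onorm B \<le> onorm (A \<otimes>\<^sub>o\<^sub>p B)"
proof (cases "k = 0")
  case True
  then show ?thesis
    using B bounded_linear_op_tensor onorm_pos_le by (auto simp: bounded_clinear_def)
next
  case False
  have lin: "bounded_linear (A \<otimes>\<^sub>o\<^sub>p B)"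
    using B by (simp add: bounded_clinear_def bounded_linear_op_tensor)
  have "onorm B \<le> onorm (A \<otimes>\<^sub>o\<^sub>p B) / cmod k"
  proof (rule onorm_bound)
    show "0 \<le> onorm (A \<otimes>\<^sub>o\<^sub>p B) / cmod k"
      by (simp add: onorm_pos_le lin)
    fix h
    have "norm c * (cmod k * norm (B h)) = norm ((A \<otimes>\<^sub>o\<^sub>p B) (pure_tensor c h))"
      by (simp add: op_tensor_pure_tensor B eigen norm_pure_tensor norm_scaleC)
    also have "\<dots> \<le> norm c * (onorm (A \<otimes>\<^sub>o\<^sub>p B) * norm h)"
      using onorm [OF lin, of "pure_tensor c h"] by (simp add: norm_pure_tensor mult_ac)
    finally show "norm (B h) \<le> onorm (A \<otimes>\<^sub>o\<^sub>p B) / cmod k * norm h"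
      using \<open>c \<noteq> 0\<close> False by (simp add: field_simps)
  qed
  then show ?thesis
    using False by (simp add: field_simps)
qed

lemma cmod_eigenvalue_mult_numerical_radius_le:
  fixes B :: "'h::chilbert_space \<Rightarrow> 'h" and A :: "complex ^ 'n ^ 'n"
  assumes B: "bounded_clinear B" and nonzero: "\<exists>x::'h. x \<noteq> 0"
    and eigen: "A *v c = k *\<^sub>C c" and "c \<noteq> 0"
  shows "cmod k * numerical_radius B \<le> numerical_radius (A \<otimes>\<^sub>o\<^sub>p B)"
proof -
  have lin: "bounded_linear (A \<otimes>\<^sub>o\<^sub>p B)"
    using B by (simp add: bounded_clinear_def bounded_linear_op_tensor)
  have le: "cmod k * cmod (cinner (B h) h) \<le> numerical_radius (A \<otimes>\<^sub>o\<^sub>p B) * (norm h)\<^sup>2" for h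
  proof -
    have "(norm c)\<^sup>2 * (cmod k * cmod (cinner (B h) h))
        = cmod (cinner ((A \<otimes>\<^sub>o\<^sub>p B) (pure_tensor c h)) (pure_tensor c h))"
      by (simp add: op_tensor_pure_tensor B eigen pure_tensor_scaleC cinner_scaleC_left
          cinner_pure_tensor cinner_self norm_mult norm_power)
    also have "\<dots> \<le> (norm c)\<^sup>2 * (numerical_radius (A \<otimes>\<^sub>o\<^sub>p B) * (norm h)\<^sup>2)"
      using cinner_le_numerical_radius [OF lin, of "pure_tensor c h"]
      by (simp add: norm_pure_tensor power_mult_distrib mult_ac)
    finally show ?thesis
      using \<open>c \<noteq> 0\<close> by simp
  qed
  show ?thesis
  proof (cases "k = 0")
    case True
    obtain h :: 'h where "h \<noteq> 0" using nonzero by blast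
    then show ?thesis
      using le [of h] True by (simp add: zero_le_mult_iff)
  next
    case False
    have "numerical_radius B \<le> numerical_radius (A \<otimes>\<^sub>o\<^sub>p B) / cmod k"
      by (rule numerical_radius_le [OF nonzero])
        (use le False in \<open>simp add: field_simps\<close>)
    then show ?thesis
      using False by (simp add: field_simps)
  qed
qed

section \<open>Direct sums of copies of one operator\<close>

definition ampliation :: "('h \<Rightarrow> 'h) \<Rightarrow> 'h ^ 'n \<Rightarrow> 'h ^ 'n"
  where "ampliation B x = (\<chi> i. B (x $ i))"

lemma norm_vec_squared: "(norm x)\<^sup>2 = (\<Sum>i\<in>UNIV. (norm (x $ i))\<^sup>2)"
  by (simp add: norm_vec_def L2_set_def sum_nonneg)

lemma norm_ampliation_squared_le:
  assumes "bounded_linear B"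
  shows "(norm (ampliation B x))\<^sup>2 \<le> (onorm B)\<^sup>2 * (norm x)\<^sup>2"
proof -
  have "(norm (ampliation B x))\<^sup>2 \<le> (\<Sum>i\<in>UNIV. (onorm B * norm (x $ i))\<^sup>2)"
    unfolding norm_vec_squared ampliation_def vec_lambda_beta
    by (intro sum_mono power_mono onorm assms norm_ge_zero)
  then show ?thesis
    by (simp add: norm_vec_squared [of x] power_mult_distrib sum_distrib_left)
qed

text \<open>
  The quadratic form of the direct sum is the sum of the quadratic forms of the components, and
  the squared norms of the components add up as well; so passing to copies does not increase the
  numerical radius.
\<close>

lemma cmod_cinner_ampliation_le:
  fixes B :: "'h::chilbert_space \<Rightarrow> 'h"
  assumes "bounded_linear B"
  shows "cmod (cinner (ampliation B x) x) \<le> numerical_radius B * (norm x)\<^sup>2"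
proof -
  have "cmod (cinner (ampliation B x) x) \<le> (\<Sum>i\<in>UNIV. cmod (cinner (B (x $ i)) (x $ i)))"
    unfolding cinner_vec_def ampliation_def vec_lambda_beta by (rule norm_sum)
  also have "\<dots> \<le> (\<Sum>i\<in>UNIV. numerical_radius B * (norm (x $ i))\<^sup>2)"
    by (intro sum_mono cinner_le_numerical_radius assms)
  finally show ?thesis
    by (simp add: norm_vec_squared sum_distrib_left)
qed

text \<open>Against a constant vector only the sum of the components matters: these two rules give all
  orthogonality relations between constant vectors and vectors of sum zero.\<close>

lemma cinner_vec_const_left: "cinner (vec h) y = cinner h (\<Sum>i\<in>UNIV. y $ i)"
  by (simp add: cinner_vec_def cinner_sum_right)

lemma cinner_vec_const_right: "cinner y (vec h) = cinner (\<Sum>i\<in>UNIV. y $ i) h"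
  by (simp add: cinner_vec_def cinner_sum_left)

section \<open>The circulant matrix with constant off-diagonal entries\<close>

lemma pos_less_CARD: "pos (i :: 'n::{finite,linorder}) < CARD('n)"
  unfolding pos_def by (rule psubset_card_mono) auto

lemma pos_less_pos: "i < j \<Longrightarrow> pos i < pos j"
  unfolding pos_def by (rule psubset_card_mono) auto

text \<open>
  The entry at \<open>(i, j)\<close> is the entry of the first row at the cyclic distance from \<open>i\<close> to \<open>j\<close>.
  Positions are distinct and less than \<open>n\<close>, so this distance is zero only on the diagonal.
\<close>

lemma Circ_nth:
  fixes i j :: "'n::{finite,linorder}"
  shows "(Circ (- a # replicate (CARD('n) - 1) b)
      :: complex ^ ('n::{finite,linorder}) ^ ('n::{finite,linorder})) $ i $ j
    = (if i = j then - a else b)"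
proof (cases "i = j")
  case True
  then show ?thesis by (simp add: Circ_def)
next
  case False
  define k where "k = (pos j + CARD('n) - pos i) mod CARD('n)"
  have "pos i \<noteq> pos j"
    using False pos_less_pos by (metis less_irrefl linorder_neqE)
  then have "k \<noteq> 0"
    using pos_less_CARD [of i] pos_less_CARD [of j]
    by (cases "pos i \<le> pos j") (auto simp: k_def mod_if)
  moreover have "k < CARD('n)"
    by (simp add: k_def)
  ultimately show ?thesis
    using False by (simp add: Circ_def nth_Cons' flip: k_def)
qed

context
  fixes a b :: complex and A :: "complex ^ ('n::finite) ^ ('n::finite)"
  assumes A_nth: "\<And>i j. A $ i $ j = (if i = j then - a else b)"
begin

lemma op_tensor_nth_const_off_diagonal:
  "(A \<otimes>\<^sub>o\<^sub>p B) x $ i = b *\<^sub>C (\<Sum>j\<in>UNIV. B (x $ j)) - (a + b) *\<^sub>C B (x $ i)"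
proof -
  have "(A \<otimes>\<^sub>o\<^sub>p B) x $ i
      = (\<Sum>j\<in>UNIV. b *\<^sub>C B (x $ j) - (if i = j then (a + b) *\<^sub>C B (x $ j) else 0))"
    unfolding op_tensor_nth A_nth
    by (rule sum.cong) (auto simp: cvs.scale_left_distrib)
  then show ?thesis
    by (simp add: sum_subtractf cvs.scale_sum_right)
qed

lemma matrix_vector_mult_const_off_diagonal:
  "(A *v c) $ i = b * (\<Sum>j\<in>UNIV. c $ j) - (a + b) * c $ i"
proof -
  have "(A *v c) $ i = (\<Sum>j\<in>UNIV. b * c $ j - (if i = j then (a + b) * c $ j else 0))"
    unfolding matrix_vector_mult_def vec_lambda_beta A_nth
    by (rule sum.cong) (auto simp: algebra_simps)
  then show ?thesis
    by (simp add: sum_subtractf sum_distrib_left)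
qed

lemma eigenvector_vec_1:
  "A *v vec 1 = ((of_nat CARD('n) - 1) * b - a) *\<^sub>C vec 1"
  by (simp add: vec_eq_iff matrix_vector_mult_const_off_diagonal scaleC_vec_def
      scaleC_complex_def algebra_simps)

lemma eigenvector_sum_0:
  assumes "(\<Sum>j\<in>UNIV. c $ j) = 0"
  shows "A *v c = - (a + b) *\<^sub>C c"
  by (simp add: vec_eq_iff matrix_vector_mult_const_off_diagonal assms scaleC_vec_def
      scaleC_complex_def algebra_simps)

text \<open>
  The splitting of \<open>x\<close> into its spectral parts, on which \<open>A \<otimes>\<^sub>o\<^sub>p B\<close> is a multiple of the ampliation of
  \<open>B\<close>. Orthogonality of \<open>u\<close> and \<open>v\<close> alone would not pass to their images under a general operator;
  the last three relations hold because an ampliation preserves both constant vectors and vectors of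
  sum zero.
\<close>

lemma op_tensor_decomposition:
  fixes B :: "'h::chilbert_space \<Rightarrow> 'h"
  assumes B: "bounded_clinear B"
  defines "\<mu> \<equiv> (of_nat CARD('n) - 1) * b - a"
  obtains u v where "(A \<otimes>\<^sub>o\<^sub>p B) x = \<mu> *\<^sub>C ampliation B u + (- (a + b)) *\<^sub>C ampliation B v"
    and "x = u + v" and "cinner u v = 0" and "cinner (ampliation B u) v = 0"
    and "cinner (ampliation B v) u = 0" and "cinner (ampliation B u) (ampliation B v) = 0"
proof -
  interpret bounded_linear B using B by (simp add: bounded_clinear_def)
  define m where "m = inverse (of_nat CARD('n)) *\<^sub>C (\<Sum>j\<in>UNIV. x $ j)"
  define u v where "u = (vec m :: 'h ^ 'n)" and "v = x - u"
  have sum_const: "(\<Sum>j\<in>(UNIV :: 'n set). h) = of_nat CARD('n) *\<^sub>C h" for h :: 'h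
    using cvs.scale_sum_left [of "\<lambda>_. 1" "UNIV :: 'n set" h] by simp
  have "(\<Sum>j\<in>UNIV. v $ j) = 0"
    by (simp add: v_def u_def sum_subtractf sum_const m_def)
  then have sum_0: "(\<Sum>j\<in>UNIV. v $ j) = 0" "(\<Sum>j\<in>UNIV. B (v $ j)) = 0"
    by (simp_all flip: sum)
  have amp_u: "ampliation B u = vec (B m)"
    by (simp add: vec_eq_iff ampliation_def u_def)
  have x: "x = u + v" by (simp add: v_def)
  have "(\<Sum>j\<in>UNIV. B (x $ j)) = of_nat CARD('n) *\<^sub>C B m"
    by (simp add: x add sum.distrib sum_0 u_def sum_const)
  then have "(A \<otimes>\<^sub>o\<^sub>p B) x = \<mu> *\<^sub>C ampliation B u + (- (a + b)) *\<^sub>C ampliation B v"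
    by (simp add: vec_eq_iff op_tensor_nth_const_off_diagonal scaleC_vec_def ampliation_def
        x add u_def \<mu>_def algebra_simps)
  moreover have "cinner u v = 0" "cinner (ampliation B u) v = 0" "cinner (ampliation B v) u = 0"
    "cinner (ampliation B u) (ampliation B v) = 0"
    unfolding amp_u unfolding u_def cinner_vec_const_left cinner_vec_const_right
    by (simp_all add: ampliation_def sum_0)
  ultimately show thesis using x that by blast
qed

text \<open>
  In both upper bounds \<open>M\<close> dominates the two eigenvalues. Pythagoras recombines the separate
  estimates for \<open>u\<close> and \<open>v\<close> into one for \<open>x = u + v\<close>.
\<close>

lemma onorm_op_tensor_le:
  fixes B :: "'h::chilbert_space \<Rightarrow> 'h"
  assumes B: "bounded_clinear B"
    and "cmod (a + b) \<le> M" and "cmod ((of_nat CARD('n) - 1) * b - a) \<le> M"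
  shows "onorm (A \<otimes>\<^sub>o\<^sub>p B) \<le> M * onorm B"
proof (rule onorm_bound)
  have lin: "bounded_linear B" using B by (simp add: bounded_clinear_def)
  have "0 \<le> M" using assms(2) norm_ge_zero order_trans by blast
  then show bound_nonneg: "0 \<le> M * onorm B" by (simp add: onorm_pos_le lin)
  fix x :: "'h ^ 'n"
  obtain u v where Tx: "(A \<otimes>\<^sub>o\<^sub>p B) x = ((of_nat CARD('n) - 1) * b - a) *\<^sub>C ampliation B u
      + (- (a + b)) *\<^sub>C ampliation B v"
    and x: "x = u + v" and orth: "cinner u v = 0"
      "cinner (ampliation B u) (ampliation B v) = 0"
    using op_tensor_decomposition [OF B] by metis
  have scaled: "(cmod k * norm (ampliation B z))\<^sup>2 \<le> (M * onorm B)\<^sup>2 * (norm z)\<^sup>2"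
    if "cmod k \<le> M" for k and z :: "'h ^ 'n"
  proof -
    have "(cmod k)\<^sup>2 * (norm (ampliation B z))\<^sup>2 \<le> M\<^sup>2 * ((onorm B)\<^sup>2 * (norm z)\<^sup>2)"
      using that by (intro mult_mono power_mono norm_ampliation_squared_le lin) auto
    then show ?thesis by (simp add: power_mult_distrib mult_ac)
  qed
  have "(norm ((A \<otimes>\<^sub>o\<^sub>p B) x))\<^sup>2
      = (cmod ((of_nat CARD('n) - 1) * b - a) * norm (ampliation B u))\<^sup>2
        + (cmod (- (a + b)) * norm (ampliation B v))\<^sup>2"
    unfolding Tx norm_add_squared cinner_scaleC_left cinner_scaleC_right orth norm_scaleC
    by simp
  also have "\<dots> \<le> (M * onorm B)\<^sup>2 * (norm u)\<^sup>2 + (M * onorm B)\<^sup>2 * (norm v)\<^sup>2"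
    by (intro add_mono scaled) (use assms in \<open>simp_all only: norm_minus_cancel\<close>)
  also have "\<dots> = (M * onorm B * norm x)\<^sup>2"
    by (simp add: x norm_add_squared orth algebra_simps)
  finally show "norm ((A \<otimes>\<^sub>o\<^sub>p B) x) \<le> M * onorm B * norm x"
    by (rule power2_le_imp_le) (simp add: bound_nonneg)
qed

lemma numerical_radius_op_tensor_le:
  fixes B :: "'h::chilbert_space \<Rightarrow> 'h"
  assumes B: "bounded_clinear B" and nonzero: "\<exists>x::'h. x \<noteq> 0"
    and "cmod (a + b) \<le> M" and "cmod ((of_nat CARD('n) - 1) * b - a) \<le> M"
  shows "numerical_radius (A \<otimes>\<^sub>o\<^sub>p B) \<le> M * numerical_radius B"
proof (rule numerical_radius_le)
  have lin: "bounded_linear B" using B by (simp add: bounded_clinear_def)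
  obtain h :: 'h where "h \<noteq> 0" using nonzero by blast
  then have "(vec h :: 'h ^ 'n) \<noteq> 0" by (simp add: vec_eq_iff)
  then show "\<exists>x :: 'h ^ 'n. x \<noteq> 0" by blast
  fix x :: "'h ^ 'n"
  obtain u v where Tx: "(A \<otimes>\<^sub>o\<^sub>p B) x = ((of_nat CARD('n) - 1) * b - a) *\<^sub>C ampliation B u
      + (- (a + b)) *\<^sub>C ampliation B v"
    and x: "x = u + v" and orth: "cinner u v = 0" "cinner (ampliation B u) v = 0"
      "cinner (ampliation B v) u = 0"
    using op_tensor_decomposition [OF B] by metis
  have scaled: "cmod (k * cinner (ampliation B z) z) \<le> M * numerical_radius B * (norm z)\<^sup>2"
    if "cmod k \<le> M" for k and z :: "'h ^ 'n"
    using mult_mono [OF that cmod_cinner_ampliation_le [OF lin, of z]] that norm_ge_zero [of k]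
    by (simp add: norm_mult mult.assoc)
  have "cmod (cinner ((A \<otimes>\<^sub>o\<^sub>p B) x) x)
      = cmod (((of_nat CARD('n) - 1) * b - a) * cinner (ampliation B u) u
        + (- (a + b)) * cinner (ampliation B v) v)"
    unfolding Tx
    unfolding x cinner_add_left cinner_add_right cinner_scaleC_left orth by simp
  also have "\<dots> \<le> M * numerical_radius B * (norm u)\<^sup>2 + M * numerical_radius B * (norm v)\<^sup>2"
    by (intro norm_triangle_le add_mono scaled)
      (use assms in \<open>simp_all only: norm_minus_cancel\<close>)
  also have "\<dots> = M * numerical_radius B * (norm x)\<^sup>2"
    by (simp add: x norm_add_squared orth algebra_simps)
  finally show "cmod (cinner ((A \<otimes>\<^sub>o\<^sub>p B) x) x) \<le> M * numerical_radius B * (norm x)\<^sup>2" .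
qed

end

theorem theorem5p1:
  fixes a b :: complex
    and A :: "complex ^ ('n::{finite,linorder}) ^ ('n::{finite,linorder})"
    and B :: "'h::chilbert_space \<Rightarrow> 'h"
  assumes n_ge_2: "CARD('n) \<ge> 2"
    and H_nonzero: "\<exists>x::'h. x \<noteq> 0"
    and B_bounded: "bounded_clinear B"
    and A_def: "A = Circ (- a # replicate (CARD('n) - 1) b)"
  shows "onorm (A \<otimes>\<^sub>o\<^sub>p B) = max (cmod (a + b)) (cmod ((of_nat CARD('n) - 1) * b - a)) * onorm B
    \<and> numerical_radius (A \<otimes>\<^sub>o\<^sub>p B)
        = max (cmod (a + b)) (cmod ((of_nat CARD('n) - 1) * b - a)) * numerical_radius B"
proof -
  define \<mu> where "\<mu> = (of_nat CARD('n) - 1) * b - a"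
  define M where "M = max (cmod (a + b)) (cmod \<mu>)"
  have A_nth: "A $ i $ j = (if i = j then - a else b)" for i j
    unfolding A_def by (rule Circ_nth)
  have M: "cmod (a + b) \<le> M" "cmod ((of_nat CARD('n) - 1) * b - a) \<le> M"
    by (simp_all add: M_def \<mu>_def)

  \<comment> \<open>A nonzero vector of sum zero is the eigenvector for \<open>- (a + b)\<close>.\<close>
  obtain i j :: 'n where "i \<noteq> j"
    using n_ge_2 card_le_Suc0_iff_eq [of "UNIV :: 'n set"] by auto
  define c :: "(complex, 'n) vec" where "c = axis i 1 - axis j 1"
  have "c $ i = 1" using \<open>i \<noteq> j\<close> by (simp add: c_def axis_def)
  then have "c \<noteq> 0" by auto
  have "(\<Sum>k\<in>UNIV. c $ k) = 0"
    by (simp add: c_def axis_def sum_subtractf)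
  then have eigen_c: "A *v c = - (a + b) *\<^sub>C c"
    by (rule eigenvector_sum_0 [OF A_nth])
  have eigen_1: "A *v vec 1 = \<mu> *\<^sub>C vec 1"
    unfolding \<mu>_def by (rule eigenvector_vec_1 [OF A_nth])
  have "(vec 1 :: (complex, 'n) vec) \<noteq> 0" by (simp add: vec_eq_iff)

  have M_cases: "M = cmod (- (a + b)) \<or> M = cmod \<mu>"
    unfolding M_def norm_minus_cancel by linarith
  have "M * onorm B \<le> onorm (A \<otimes>\<^sub>o\<^sub>p B)"
    using M_cases cmod_eigenvalue_mult_onorm_le [OF B_bounded eigen_c \<open>c \<noteq> 0\<close>]
      cmod_eigenvalue_mult_onorm_le [OF B_bounded eigen_1 \<open>vec 1 \<noteq> 0\<close>] by metis
  moreover have "M * numerical_radius B \<le> numerical_radius (A \<otimes>\<^sub>o\<^sub>p B)"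
    using M_cases
      cmod_eigenvalue_mult_numerical_radius_le [OF B_bounded H_nonzero eigen_c \<open>c \<noteq> 0\<close>]
      cmod_eigenvalue_mult_numerical_radius_le [OF B_bounded H_nonzero eigen_1 \<open>vec 1 \<noteq> 0\<close>]
    by metis
  ultimately show ?thesis
    using onorm_op_tensor_le [OF A_nth B_bounded M]
      numerical_radius_op_tensor_le [OF A_nth B_bounded H_nonzero M]
    unfolding M_def \<mu>_def by (intro conjI antisym)
qed

end
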